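(* Let $G$ be a definable group, and let $\mathrm{Mean}(G)$ be the set of means over $\ell\text{-RUC}(G)$, endowed with the $\sigma$-topology generated by the sets $\mathcal U_{f,V}=\{F\in\mathrm{Mean}(G) : F(f)\in V\}$ with $f\in\ell\text{-RUC}(G)$ and $V\subseteq\mathbb R$ open. Then the canonical action of $G$ on $\mathrm{Mean}(G)$, given by $(g\cdot F)(f)=F({}_gf)$ where ${}_gf(x)=f(gx)$, is $\sigma$-continuous.
   Context: A definable group is a group $G$ whose underlying set and group operation are definable in some first-order structure $M$; "definable" means definable with parameters from $M$. A $\sigma$-topology on a set $X$ is a family $\Sigma$ of subsets of $X$ containing $\emptyset$ and $X$ and closed under finite intersections and countable unions; its members are called $\sigma$-open. The $\sigma$-topology generated by a family of subsets is the smallest $\sigma$-topology containing it. A map between $\sigma$-topological spaces is $\sigma$-continuous if preimages of $\sigma$-open sets are $\sigma$-open. A function $f:G\to\mathbb R$ is logically right uniformly continuous if for each $\varepsilon>0$ there are definable subsets $(\Theta_n^{\varepsilon})_{n<\omega}$ of $G$ with $G\subseteq\bigcup_{n<\omega}\Theta_n^{\varepsilon}$ such that whenever $g_1,g_2\in\Theta_n^{\varepsilon}$ for some $n$, one has $|f(g_1h)-f(g_2h)|<\varepsilon$ for every $h\in G$. $\ell\text{-RUC}(G)$ is the space of bounded logically right uniformly continuous functions $G\to\mathbb R$, with the supremum norm. A mean over $\ell\text{-RUC}(G)$ is a linear functional $F:\ell\text{-RUC}(G)\to\mathbb R$ with $\inf_{x\in G} f(x)\le F(f)\le\sup_{x\in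 G} f(x)$ for all $f$. The action of $G$ on $\mathrm{Mean}(G)$ is $\sigma$-continuous if it is a $\sigma$-continuous map $G\times\mathrm{Mean}(G)\to\mathrm{Mean}(G)$, where $G\times\mathrm{Mean}(G)$ carries the $\sigma$-topology generated by the sets $D\times W$ with $D\subseteq G$ definable and $W$ a finite intersection of sets $\mathcal U_{f,V}$. *)

theory Defs
  imports Complex_Main "HOL-Library.Countable_Set" "HOL-Algebra.Group"
begin

section \<open>First-order structures and definability with parameters\<close>

datatype 'f fo_term = Var nat | App 'f "'f fo_term list"

datatype ('f, 'r) fo_formula =
    Eq "'f fo_term" "'f fo_term"
  | Rel 'r "'f fo_term list"
  | Neg "('f, 'r) fo_formula"
  | Conj "('f, 'r) fo_formula" "('f, 'r) fo_formula"
  | Ex nat "('f, 'r) fo_formula"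

text \<open>The language is recorded by the arity maps: a symbol belongs to it iff it has an arity.
  The maps are partial because HOL types are nonempty, so that a language without
  function symbols (or without relation symbols) could not be given by a type alone.\<close>

record ('f, 'r, 'm) fo_structure =
  univ :: "'m set"
  fun_arity :: "'f \<Rightarrow> nat option"
  rel_arity :: "'r \<Rightarrow> nat option"
  fun_interp :: "'f \<Rightarrow> 'm list \<Rightarrow> 'm"
  rel_interp :: "'r \<Rightarrow> 'm list \<Rightarrow> bool"

definition tuples :: "'m set \<Rightarrow> nat \<Rightarrow> 'm list set" where
  "tuples A n = {xs. length xs = n \<and> set xs \<subseteq> A}"

definition is_fo_structure :: "('f, 'r, 'm) fo_structure \<Rightarrow> bool" where
  "is_fo_structure M \<longleftrightarrow>
     univ M \<noteq> {} \<and>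
     (\<forall>f k. fun_arity M f = Some k \<longrightarrow> fun_interp M f \<in> tuples (univ M) k \<rightarrow> univ M)"

primrec wf_term :: "('f, 'r, 'm) fo_structure \<Rightarrow> 'f fo_term \<Rightarrow> bool" where
  "wf_term M (Var i) = True"
| "wf_term M (App f ts) = (fun_arity M f = Some (length ts) \<and> list_all (wf_term M) ts)"

primrec wf_formula :: "('f, 'r, 'm) fo_structure \<Rightarrow> ('f, 'r) fo_formula \<Rightarrow> bool" where
  "wf_formula M (Eq s t) = (wf_term M s \<and> wf_term M t)"
| "wf_formula M (Rel r ts) = (rel_arity M r = Some (length ts) \<and> list_all (wf_term M) ts)"
| "wf_formula M (Neg \<phi>) = wf_formula M \<phi>"
| "wf_formula M (Conj \<phi> \<psi>) = (wf_formula M \<phi> \<and> wf_formula M \<psi>)"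
| "wf_formula M (Ex i \<phi>) = wf_formula M \<phi>"

primrec term_val :: "('f, 'r, 'm) fo_structure \<Rightarrow> (nat \<Rightarrow> 'm) \<Rightarrow> 'f fo_term \<Rightarrow> 'm" where
  "term_val M e (Var i) = e i"
| "term_val M e (App f ts) = fun_interp M f (map (term_val M e) ts)"

primrec sat :: "('f, 'r, 'm) fo_structure \<Rightarrow> (nat \<Rightarrow> 'm) \<Rightarrow> ('f, 'r) fo_formula \<Rightarrow> bool" where
  "sat M e (Eq s t) = (term_val M e s = term_val M e t)"
| "sat M e (Rel r ts) = rel_interp M r (map (term_val M e) ts)"
| "sat M e (Neg \<phi>) = (\<not> sat M e \<phi>)"
| "sat M e (Conj \<phi> \<psi>) = (sat M e \<phi> \<and> sat M e \<psi>)"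
| "sat M e (Ex i \<phi>) = (\<exists>a \<in> univ M. sat M (e(i := a)) \<phi>)"

text \<open>Variables below \<open>n\<close> range over the coordinates; every other free variable \<open>i\<close> is
  replaced by the parameter \<open>p i\<close>. A formula has finitely many free variables, so only
  finitely many values of \<open>p\<close> matter.\<close>

definition definable :: "('f, 'r, 'm) fo_structure \<Rightarrow> nat \<Rightarrow> 'm list set \<Rightarrow> bool" where
  "definable M n D \<longleftrightarrow>
     (\<exists>\<phi> p. wf_formula M \<phi> \<and> range p \<subseteq> univ M \<and>
        D = {xs \<in> tuples (univ M) n. sat M (\<lambda>i. if i < n then xs ! i else p i) \<phi>})"

definition definable_group ::
    "('f, 'r, 'm) fo_structure \<Rightarrow> nat \<Rightarrow> ('m list, 'b) monoid_scheme \<Rightarrow> bool" where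
  "definable_group M n G \<longleftrightarrow>
     is_fo_structure M \<and> group G \<and> definable M n (carrier G) \<and>
     definable M (3 * n) {x @ y @ (x \<otimes>\<^bsub>G\<^esub> y) | x y. x \<in> carrier G \<and> y \<in> carrier G}"

section \<open>Sigma-topologies\<close>

definition sigma_topology :: "'a set \<Rightarrow> 'a set set \<Rightarrow> bool" where
  "sigma_topology X \<Sigma> \<longleftrightarrow>
     \<Sigma> \<subseteq> Pow X \<and> {} \<in> \<Sigma> \<and> X \<in> \<Sigma> \<and>
     (\<forall>A\<in>\<Sigma>. \<forall>B\<in>\<Sigma>. A \<inter> B \<in> \<Sigma>) \<and>
     (\<forall>\<A>. \<A> \<subseteq> \<Sigma> \<and> countable \<A> \<longrightarrow> \<Union>\<A> \<in> \<Sigma>)"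

definition sigma_topology_generated_by :: "'a set \<Rightarrow> 'a set set \<Rightarrow> 'a set set" where
  "sigma_topology_generated_by X \<B> = \<Inter>{\<Sigma>. sigma_topology X \<Sigma> \<and> \<B> \<subseteq> \<Sigma>}"

lemma sigma_topology_Pow: "sigma_topology X (Pow X)"
  unfolding sigma_topology_def by blast

lemma sigma_topology_generated_by:
  assumes "\<B> \<subseteq> Pow X"
  shows "sigma_topology X (sigma_topology_generated_by X \<B>)"
    and "\<B> \<subseteq> sigma_topology_generated_by X \<B>"
    and "sigma_topology X \<Sigma> \<Longrightarrow> \<B> \<subseteq> \<Sigma> \<Longrightarrow> sigma_topology_generated_by X \<B> \<subseteq> \<Sigma>"
proof -
  let ?F = "{\<Sigma>. sigma_topology X \<Sigma> \<and> \<B> \<subseteq> \<Sigma>}"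
  have sub: "\<Inter>?F \<subseteq> Pow X"
    using assms sigma_topology_Pow[of X] by blast
  have un: "\<Union>\<A> \<in> \<Inter>?F" if "\<A> \<subseteq> \<Inter>?F" "countable \<A>" for \<A>
  proof
    fix \<Sigma> assume "\<Sigma> \<in> ?F"
    moreover from this have "\<A> \<subseteq> \<Sigma>" using that(1) by blast
    ultimately show "\<Union>\<A> \<in> \<Sigma>" using that(2) by (simp add: sigma_topology_def)
  qed
  have int: "A \<inter> B \<in> \<Inter>?F" if "A \<in> \<Inter>?F" "B \<in> \<Inter>?F" for A B
    using that by (simp add: sigma_topology_def)
  have triv: "{} \<in> \<Inter>?F" "X \<in> \<Inter>?F"
    by (simp_all add: sigma_topology_def)
  show "sigma_topology X (sigma_topology_generated_by X \<B>)"
    unfolding sigma_topology_generated_by_def sigma_topology_def[of X "\<Inter>?F"]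
  proof (intro conjI ballI allI impI)
    show "\<Inter>?F \<subseteq> Pow X" by (rule sub)
    show "{} \<in> \<Inter>?F" "X \<in> \<Inter>?F" by (rule triv)+
    show "A \<inter> B \<in> \<Inter>?F" if "A \<in> \<Inter>?F" "B \<in> \<Inter>?F" for A B
      using that by (rule int)
    show "\<Union>\<A> \<in> \<Inter>?F" if "\<A> \<subseteq> \<Inter>?F \<and> countable \<A>" for \<A>
      using that un by (elim conjE)
  qed
  show "\<B> \<subseteq> sigma_topology_generated_by X \<B>"
    unfolding sigma_topology_generated_by_def by blast
  show "sigma_topology X \<Sigma> \<Longrightarrow> \<B> \<subseteq> \<Sigma> \<Longrightarrow> sigma_topology_generated_by X \<B> \<subseteq> \<Sigma>"
    unfolding sigma_topology_generated_by_def by blast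
qed

definition sigma_continuous_map ::
    "'a set \<Rightarrow> 'a set set \<Rightarrow> 'b set \<Rightarrow> 'b set set \<Rightarrow> ('a \<Rightarrow> 'b) \<Rightarrow> bool" where
  "sigma_continuous_map X \<Sigma> Y \<T> \<phi> \<longleftrightarrow>
     \<phi> \<in> X \<rightarrow> Y \<and> (\<forall>W\<in>\<T>. {x \<in> X. \<phi> x \<in> W} \<in> \<Sigma>)"

section \<open>Logically right uniformly continuous functions and means\<close>

definition logically_ruc ::
    "('f, 'r, 'm) fo_structure \<Rightarrow> nat \<Rightarrow> ('m list, 'b) monoid_scheme \<Rightarrow> ('m list \<Rightarrow> real) \<Rightarrow> bool"
  where
  "logically_ruc M n G f \<longleftrightarrow>
     (\<forall>\<epsilon>>0. \<exists>\<Theta> :: nat \<Rightarrow> 'm list set.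
        (\<forall>k. definable M n (\<Theta> k) \<and> \<Theta> k \<subseteq> carrier G) \<and>
        carrier G \<subseteq> (\<Union>k. \<Theta> k) \<and>
        (\<forall>k. \<forall>g\<^sub>1\<in>\<Theta> k. \<forall>g\<^sub>2\<in>\<Theta> k. \<forall>h\<in>carrier G.
           \<bar>f (g\<^sub>1 \<otimes>\<^bsub>G\<^esub> h) - f (g\<^sub>2 \<otimes>\<^bsub>G\<^esub> h)\<bar> < \<epsilon>))"

text \<open>Functions with domain \<open>carrier G\<close> are represented extensionally, so that equality
  of elements of \<open>lRUC\<close> is equality of functions on \<open>G\<close>. The same convention
  is used below for functionals with domain \<open>lRUC M n G\<close>.\<close>

definition lRUC ::
    "('f, 'r, 'm) fo_structure \<Rightarrow> nat \<Rightarrow> ('m list, 'b) monoid_scheme \<Rightarrow> ('m list \<Rightarrow> real) set" where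
  "lRUC M n G =
     {f \<in> extensional (carrier G).
        (\<exists>B. \<forall>x\<in>carrier G. \<bar>f x\<bar> \<le> B) \<and> logically_ruc M n G f}"

definition Mean ::
    "('f, 'r, 'm) fo_structure \<Rightarrow> nat \<Rightarrow> ('m list, 'b) monoid_scheme
       \<Rightarrow> (('m list \<Rightarrow> real) \<Rightarrow> real) set" where
  "Mean M n G =
     {F \<in> extensional (lRUC M n G).
        (\<forall>f\<in>lRUC M n G. \<forall>h\<in>lRUC M n G. F (\<lambda>x\<in>carrier G. f x + h x) = F f + F h) \<and>
        (\<forall>c. \<forall>f\<in>lRUC M n G. F (\<lambda>x\<in>carrier G. c * f x) = c * F f) \<and>
        (\<forall>f\<in>lRUC M n G. (INF x\<in>carrier G. f x) \<le> F f \<and> F f \<le> (SUP x\<in>carrier G. f x))}"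

definition mean_subbasis ::
    "('f, 'r, 'm) fo_structure \<Rightarrow> nat \<Rightarrow> ('m list, 'b) monoid_scheme
       \<Rightarrow> (('m list \<Rightarrow> real) \<Rightarrow> real) set set" where
  "mean_subbasis M n G = {{F \<in> Mean M n G. F f \<in> V} | f V. f \<in> lRUC M n G \<and> open V}"

definition mean_sigma ::
    "('f, 'r, 'm) fo_structure \<Rightarrow> nat \<Rightarrow> ('m list, 'b) monoid_scheme
       \<Rightarrow> (('m list \<Rightarrow> real) \<Rightarrow> real) set set" where
  "mean_sigma M n G = sigma_topology_generated_by (Mean M n G) (mean_subbasis M n G)"

text \<open>Intersecting with \<open>Mean M n G\<close> gives the empty intersection its meaning.\<close>

definition group_mean_sigma ::
    "('f, 'r, 'm) fo_structure \<Rightarrow> nat \<Rightarrow> ('m list, 'b) monoid_scheme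
       \<Rightarrow> ('m list \<times> (('m list \<Rightarrow> real) \<Rightarrow> real)) set set" where
  "group_mean_sigma M n G =
     sigma_topology_generated_by (carrier G \<times> Mean M n G)
       {D \<times> (Mean M n G \<inter> \<Inter>\<W>) | D \<W>.
          definable M n D \<and> D \<subseteq> carrier G \<and> finite \<W> \<and> \<W> \<subseteq> mean_subbasis M n G}"

definition translate ::
    "('a, 'b) monoid_scheme \<Rightarrow> 'a \<Rightarrow> ('a \<Rightarrow> real) \<Rightarrow> 'a \<Rightarrow> real" where
  "translate G g f = (\<lambda>x\<in>carrier G. f (g \<otimes>\<^bsub>G\<^esub> x))"

definition mean_action ::
    "('f, 'r, 'm) fo_structure \<Rightarrow> nat \<Rightarrow> ('m list, 'b) monoid_scheme
       \<Rightarrow> 'm list \<Rightarrow> (('m list \<Rightarrow> real) \<Rightarrow> real) \<Rightarrow> ('m list \<Rightarrow> real) \<Rightarrow> real" where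
  "mean_action M n G g F = (\<lambda>f\<in>lRUC M n G. F (translate G g f))"

end

theory Submission
  imports Defs
begin

text \<open>
  Two facts carry the proof. The first is that \<open>\<ell>\<close>-RUC is closed under left translation
  (\<open>lRUC_translate\<close>), without which the action would not even be defined: if the sets \<open>\<Theta> k\<close>
  witness uniform continuity of \<open>f\<close> up to \<open>\<epsilon>\<close>, then their preimages under \<open>x \<mapsto> g x\<close> witness
  it for \<open>x \<mapsto> f (g x)\<close>. These preimages are definable
  (\<open>definable_left_translation_preimage\<close>): the preimage of \<open>D\<close> is obtained from the graph of
  multiplication by fixing the first argument, intersecting with the cylinder over \<open>D\<close> and
  projecting. Since the values at non-coordinate variables are free parameters, sections,
  cylinders and intersections only require variables to be renamed along an injection, and
  a projection is an existential quantifier.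

  The second is that a mean is Lipschitz with constant 1 for the supremum distance
  (\<open>Mean_diff_le\<close>). Hence, if \<open>g\<^sub>1\<close> and \<open>g\<^sub>2\<close> lie in the same \<open>\<Theta> k\<close>, the translates of \<open>f\<close> by
  \<open>g\<^sub>1\<close> and \<open>g\<^sub>2\<close> are uniformly \<open>\<epsilon>\<close>-close, and so are their values under \<^emph>\<open>every\<close> mean \<open>F\<close>. To
  know up to \<open>\<epsilon>\<close> where \<open>F\<close> sends the translate of \<open>f\<close> by \<open>g\<close>, it therefore suffices to know
  a \<open>k\<close> with \<open>g \<in> \<Theta> k\<close> and the value of \<open>F\<close> at the translate by one chosen representative
  of \<open>\<Theta> k\<close>. Letting \<open>\<epsilon>\<close> run through a null sequence, the preimage of a subbasic set of means
  becomes a countable union of products of a definable set and a subbasic set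
  (\<open>mean_action_preimage_sigma_open\<close>).
\<close>

section \<open>Renaming variables\<close>

primrec rename_term :: "(nat \<Rightarrow> nat) \<Rightarrow> 'f fo_term \<Rightarrow> 'f fo_term" where
  "rename_term \<rho> (Var i) = Var (\<rho> i)"
| "rename_term \<rho> (App f ts) = App f (map (rename_term \<rho>) ts)"

primrec rename_formula :: "(nat \<Rightarrow> nat) \<Rightarrow> ('f, 'r) fo_formula \<Rightarrow> ('f, 'r) fo_formula" where
  "rename_formula \<rho> (Eq s t) = Eq (rename_term \<rho> s) (rename_term \<rho> t)"
| "rename_formula \<rho> (Rel r ts) = Rel r (map (rename_term \<rho>) ts)"
| "rename_formula \<rho> (Neg \<phi>) = Neg (rename_formula \<rho> \<phi>)"
| "rename_formula \<rho> (Conj \<phi> \<psi>) = Conj (rename_formula \<rho> \<phi>) (rename_formula \<rho> \<psi>)"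
| "rename_formula \<rho> (Ex i \<phi>) = Ex (\<rho> i) (rename_formula \<rho> \<phi>)"

lemma wf_rename_term: "wf_term M t \<Longrightarrow> wf_term M (rename_term \<rho> t)"
  by (induction t) (auto simp: list_all_iff)

lemma wf_rename_formula: "wf_formula M \<phi> \<Longrightarrow> wf_formula M (rename_formula \<rho> \<phi>)"
  by (induction \<phi>) (auto simp: list_all_iff wf_rename_term)

lemma term_val_rename: "term_val M e (rename_term \<rho> t) = term_val M (e \<circ> \<rho>) t"
  by (induction t) (auto intro!: arg_cong[where f = "fun_interp M _"])

text \<open>Bound variables are renamed as well; injectivity of \<open>\<rho>\<close> is what prevents capture.\<close>

lemma sat_rename:
  assumes "inj \<rho>"
  shows "sat M e (rename_formula \<rho> \<phi>) = sat M (e \<circ> \<rho>) \<phi>"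
proof (induction \<phi> arbitrary: e)
  case (Rel r ts)
  have "map (term_val M e) (map (rename_term \<rho>) ts) = map (term_val M (e \<circ> \<rho>)) ts"
    by (simp add: term_val_rename)
  then show ?case by (simp only: rename_formula.simps sat.simps)
next
  case (Ex i \<phi>)
  have "e(\<rho> i := a) \<circ> \<rho> = (e \<circ> \<rho>)(i := a)" for a
    using assms by (auto simp: fun_eq_iff inj_def)
  then have "sat M (e(\<rho> i := a)) (rename_formula \<rho> \<phi>) = sat M ((e \<circ> \<rho>)(i := a)) \<phi>" for a
    by (simp only: Ex.IH)
  then show ?case by (simp only: rename_formula.simps sat.simps)
qed (simp_all add: term_val_rename)

section \<open>Closure properties of definable sets\<close>

lemma definable_subset_tuples: "definable M n D \<Longrightarrow> D \<subseteq> tuples (univ M) n"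
  unfolding definable_def by blast

lemma definableI:
  assumes "wf_formula M \<phi>" "range p \<subseteq> univ M" "D \<subseteq> tuples (univ M) n"
    and "\<And>xs. xs \<in> tuples (univ M) n \<Longrightarrow> xs \<in> D \<longleftrightarrow> sat M (\<lambda>i. if i < n then xs ! i else p i) \<phi>"
  shows "definable M n D"
  unfolding definable_def using assms by blast

lemma definableE:
  assumes "definable M n D"
  obtains \<phi> p where "wf_formula M \<phi>" "range p \<subseteq> univ M"
    and "\<And>xs. xs \<in> tuples (univ M) n \<Longrightarrow> xs \<in> D \<longleftrightarrow> sat M (\<lambda>i. if i < n then xs ! i else p i) \<phi>"
  using assms unfolding definable_def by blast

text \<open>The two defining formulas may use the same variable for different parameters. The
  parameters of the first are moved to the positions \<open>n, n + 2, \<dots>\<close> and those of the second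
  to \<open>n + 1, n + 3, \<dots>\<close>.\<close>

lemma definable_Int:
  assumes "definable M n D" "definable M n E"
  shows "definable M n (D \<inter> E)"
proof -
  obtain \<phi> p where \<phi>: "wf_formula M \<phi>" "range p \<subseteq> univ M"
    "\<And>xs. xs \<in> tuples (univ M) n \<Longrightarrow> xs \<in> D \<longleftrightarrow> sat M (\<lambda>i. if i < n then xs ! i else p i) \<phi>"
    using definableE[OF assms(1)] by blast
  obtain \<psi> q where \<psi>: "wf_formula M \<psi>" "range q \<subseteq> univ M"
    "\<And>xs. xs \<in> tuples (univ M) n \<Longrightarrow> xs \<in> E \<longleftrightarrow> sat M (\<lambda>i. if i < n then xs ! i else q i) \<psi>"
    using definableE[OF assms(2)] by blast
  define \<rho> where "\<rho> = (\<lambda>i. if i < n then i else n + 2 * (i - n))"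
  define \<sigma> where "\<sigma> = (\<lambda>i. if i < n then i else n + 2 * (i - n) + 1)"
  define r where "r = (\<lambda>i. if even (i - n) then p (n + (i - n) div 2) else q (n + (i - n) div 2))"
  have inj: "inj \<rho>" "inj \<sigma>"
    unfolding \<rho>_def \<sigma>_def inj_def by (auto split: if_splits)
  have \<rho>: "(\<lambda>i. if i < n then xs ! i else r i) \<circ> \<rho> = (\<lambda>i. if i < n then xs ! i else p i)" for xs
    by (auto simp: fun_eq_iff \<rho>_def r_def)
  have \<sigma>: "(\<lambda>i. if i < n then xs ! i else r i) \<circ> \<sigma> = (\<lambda>i. if i < n then xs ! i else q i)" for xs
    by (auto simp: fun_eq_iff \<sigma>_def r_def)
  show ?thesis
  proof (rule definableI)
    show "wf_formula M (Conj (rename_formula \<rho> \<phi>) (rename_formula \<sigma> \<psi>))"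
      using \<phi>(1) \<psi>(1) by (simp add: wf_rename_formula)
    show "range r \<subseteq> univ M"
      using \<phi>(2) \<psi>(2) by (auto simp: r_def)
    show "D \<inter> E \<subseteq> tuples (univ M) n"
      using definable_subset_tuples[OF assms(1)] by blast
  qed (simp add: sat_rename inj \<rho> \<sigma> \<phi>(3) \<psi>(3))
qed

text \<open>The renaming swaps the first block of \<open>n\<close> variables with the second block of \<open>m\<close> variables:
  the fixed coordinates become parameters, which have to follow the remaining coordinates.\<close>

lemma definable_section:
  assumes "definable M (n + m) D" "xs \<in> tuples (univ M) n"
  shows "definable M m {ys \<in> tuples (univ M) m. xs @ ys \<in> D}"
proof -
  obtain \<phi> p where \<phi>: "wf_formula M \<phi>" "range p \<subseteq> univ M"
    "\<And>zs. zs \<in> tuples (univ M) (n + m) \<Longrightarrow>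
       zs \<in> D \<longleftrightarrow> sat M (\<lambda>i. if i < n + m then zs ! i else p i) \<phi>"
    using definableE[OF assms(1)] by blast
  define \<rho> where "\<rho> = (\<lambda>i. if i < n then m + i else if i < n + m then i - n else i)"
  define q where "q = (\<lambda>i. if m \<le> i \<and> i < m + n then xs ! (i - m) else p i)"
  have xs: "length xs = n" "set xs \<subseteq> univ M"
    using assms(2) by (auto simp: tuples_def)
  have inj: "inj \<rho>"
    unfolding \<rho>_def inj_def by (auto split: if_splits)
  have \<rho>: "(\<lambda>i. if i < m then ys ! i else q i) \<circ> \<rho>
            = (\<lambda>i. if i < n + m then (xs @ ys) ! i else p i)" for ys
    using xs(1) by (auto simp: fun_eq_iff \<rho>_def q_def nth_append)
  show ?thesis
  proof (rule definableI)
    show "wf_formula M (rename_formula \<rho> \<phi>)"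
      using \<phi>(1) by (rule wf_rename_formula)
    show "range q \<subseteq> univ M"
    proof
      fix a assume "a \<in> range q"
      then obtain i where "a = q i" by blast
      then show "a \<in> univ M"
        using \<phi>(2) xs by (cases "m \<le> i \<and> i < m + n") (auto simp: q_def subset_iff)
    qed
  next
    fix ys assume ys: "ys \<in> tuples (univ M) m"
    then have "xs @ ys \<in> tuples (univ M) (n + m)"
      using xs by (auto simp: tuples_def)
    then show "ys \<in> {ys \<in> tuples (univ M) m. xs @ ys \<in> D} \<longleftrightarrow>
        sat M (\<lambda>i. if i < m then ys ! i else q i) (rename_formula \<rho> \<phi>)"
      using ys by (simp add: sat_rename inj \<rho> \<phi>(3))
  qed blast
qed

lemma definable_cylinder:
  assumes "definable M m D"
  shows "definable M (n + m) {zs \<in> tuples (univ M) (n + m). drop n zs \<in> D}"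
proof -
  obtain \<phi> p where \<phi>: "wf_formula M \<phi>" "range p \<subseteq> univ M"
    "\<And>xs. xs \<in> tuples (univ M) m \<Longrightarrow> xs \<in> D \<longleftrightarrow> sat M (\<lambda>i. if i < m then xs ! i else p i) \<phi>"
    using definableE[OF assms(1)] by blast
  have inj: "inj ((+) n)" by (simp add: inj_def)
  show ?thesis
  proof (rule definableI)
    show "wf_formula M (rename_formula ((+) n) \<phi>)"
      using \<phi>(1) by (rule wf_rename_formula)
    show "range (\<lambda>i. p (i - n)) \<subseteq> univ M"
      using \<phi>(2) by blast
  next
    fix zs assume zs: "zs \<in> tuples (univ M) (n + m)"
    then have "drop n zs \<in> tuples (univ M) m"
      using set_drop_subset[of n zs] by (auto simp: tuples_def)
    moreover have "(\<lambda>i. if i < n + m then zs ! i else p (i - n)) \<circ> (+) n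
                   = (\<lambda>i. if i < m then drop n zs ! i else p i)"
      using zs by (auto simp: fun_eq_iff tuples_def)
    ultimately show "zs \<in> {zs \<in> tuples (univ M) (n + m). drop n zs \<in> D} \<longleftrightarrow>
        sat M (\<lambda>i. if i < n + m then zs ! i else p (i - n)) (rename_formula ((+) n) \<phi>)"
      using zs by (simp add: sat_rename inj \<phi>(3))
  qed blast
qed

text \<open>Only the last coordinate is projected away: then its variable \<open>n\<close> lies directly behind the
  remaining coordinates, and one quantifier does the job without any renaming.\<close>

lemma definable_projection_one:
  assumes "definable M (Suc n) D"
  shows "definable M n {xs \<in> tuples (univ M) n. \<exists>a\<in>univ M. xs @ [a] \<in> D}"
proof -
  obtain \<phi> p where \<phi>: "wf_formula M \<phi>" "range p \<subseteq> univ M"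
    "\<And>zs. zs \<in> tuples (univ M) (Suc n) \<Longrightarrow>
       zs \<in> D \<longleftrightarrow> sat M (\<lambda>i. if i < Suc n then zs ! i else p i) \<phi>"
    using definableE[OF assms(1)] by blast
  show ?thesis
  proof (rule definableI)
    show "wf_formula M (Ex n \<phi>)" using \<phi>(1) by simp
    show "range p \<subseteq> univ M" by (rule \<phi>(2))
  next
    fix xs assume xs: "xs \<in> tuples (univ M) n"
    have "xs @ [a] \<in> D \<longleftrightarrow> sat M ((\<lambda>i. if i < n then xs ! i else p i)(n := a)) \<phi>"
      if "a \<in> univ M" for a
    proof -
      have "(\<lambda>i. if i < Suc n then (xs @ [a]) ! i else p i)
            = (\<lambda>i. if i < n then xs ! i else p i)(n := a)"
        using xs by (auto simp: fun_eq_iff tuples_def nth_append)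
      moreover have "xs @ [a] \<in> tuples (univ M) (Suc n)"
        using xs that by (auto simp: tuples_def)
      ultimately show ?thesis by (simp add: \<phi>(3))
    qed
    then show "xs \<in> {xs \<in> tuples (univ M) n. \<exists>a\<in>univ M. xs @ [a] \<in> D} \<longleftrightarrow>
        sat M (\<lambda>i. if i < n then xs ! i else p i) (Ex n \<phi>)"
      using xs by simp
  qed blast
qed

lemma definable_projection:
  assumes "definable M (n + k) D"
  shows "definable M n {xs \<in> tuples (univ M) n. \<exists>ys\<in>tuples (univ M) k. xs @ ys \<in> D}"
  using assms
proof (induction k arbitrary: D)
  case 0
  have "{xs \<in> tuples (univ M) n. \<exists>ys\<in>tuples (univ M) 0. xs @ ys \<in> D} = D"
    using definable_subset_tuples[OF "0.prems"] by (auto simp: tuples_def)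
  with 0 show ?case by simp
next
  case (Suc k)
  let ?D = "{zs \<in> tuples (univ M) (n + k). \<exists>a\<in>univ M. zs @ [a] \<in> D}"
  have "definable M (n + k) ?D"
    using Suc.prems by (intro definable_projection_one) simp
  from Suc.IH[OF this]
  have "definable M n {xs \<in> tuples (univ M) n. \<exists>ys\<in>tuples (univ M) k. xs @ ys \<in> ?D}" .
  moreover have "(\<exists>ys\<in>tuples (univ M) k. xs @ ys \<in> ?D) \<longleftrightarrow>
      (\<exists>ys\<in>tuples (univ M) (Suc k). xs @ ys \<in> D)" (is "?l \<longleftrightarrow> ?r")
    if xs: "xs \<in> tuples (univ M) n" for xs
  proof
    assume ?l
    then obtain ys a where "ys \<in> tuples (univ M) k" "a \<in> univ M" "xs @ ys @ [a] \<in> D" by auto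
    moreover from this have "ys @ [a] \<in> tuples (univ M) (Suc k)"
      by (auto simp: tuples_def)
    ultimately show ?r by blast
  next
    assume ?r
    then obtain ys where ys: "ys \<in> tuples (univ M) (Suc k)" "xs @ ys \<in> D" by blast
    then obtain zs a where zs: "ys = zs @ [a]"
      by (cases ys rule: rev_cases) (auto simp: tuples_def)
    with ys xs have "zs \<in> tuples (univ M) k" "a \<in> univ M" "xs @ zs \<in> tuples (univ M) (n + k)"
      by (auto simp: tuples_def)
    with ys zs show ?l by auto
  qed
  ultimately show ?case by (simp cong: conj_cong)
qed

lemma definable_group_carrier:
  assumes "definable_group M n G"
  shows "group G" "carrier G \<subseteq> tuples (univ M) n"
  using assms definable_subset_tuples by (auto simp: definable_group_def)

lemma definable_left_translation_preimage:
  assumes G: "definable_group M n G" and g: "g \<in> carrier G"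
    and D: "definable M n D" "D \<subseteq> carrier G"
  shows "definable M n {x \<in> carrier G. g \<otimes>\<^bsub>G\<^esub> x \<in> D}"
proof -
  let ?\<Gamma> = "{x @ y @ (x \<otimes>\<^bsub>G\<^esub> y) | x y. x \<in> carrier G \<and> y \<in> carrier G}"
  let ?S = "{zs \<in> tuples (univ M) (n + n). g @ zs \<in> ?\<Gamma>}"
  let ?C = "{zs \<in> tuples (univ M) (n + n). drop n zs \<in> D}"
  let ?P = "{xs \<in> tuples (univ M) n. \<exists>ys\<in>tuples (univ M) n. xs @ ys \<in> ?S \<inter> ?C}"
  interpret group G using definable_group_carrier(1)[OF G] .
  have tup: "\<And>x. x \<in> carrier G \<Longrightarrow> x \<in> tuples (univ M) n"
    using definable_group_carrier(2)[OF G] by blast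
  then have len: "\<And>x. x \<in> carrier G \<Longrightarrow> length x = n"
    by (auto simp: tuples_def)
  have "3 * n = n + (n + n)" by simp
  with G have "definable M (n + (n + n)) ?\<Gamma>"
    unfolding definable_group_def by metis
  then have "definable M (n + n) ?S"
    using tup[OF g] by (rule definable_section)
  then have "definable M n ?P"
    using definable_cylinder[OF D(1), of n]
    by (intro definable_projection definable_Int)
  moreover have "?P = {x \<in> carrier G. g \<otimes>\<^bsub>G\<^esub> x \<in> D}"
  proof (intro equalityI subsetI)
    fix x assume "x \<in> ?P"
    then obtain y where x: "length x = n" and y: "g @ x @ y \<in> ?\<Gamma>" "drop n (x @ y) \<in> D"
      unfolding tuples_def by blast
    from y(2) x have "y \<in> D" by simp
    from y(1) obtain a b where ab: "g @ x @ y = a @ b @ (a \<otimes>\<^bsub>G\<^esub> b)" "a \<in> carrier G" "b \<in> carrier G"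
      by blast
    have "length g = length a" "length x = length b"
      using len g x ab(2,3) by simp_all
    with ab(1) have "g = a" "x = b" "y = a \<otimes>\<^bsub>G\<^esub> b"
      by simp_all
    with ab \<open>y \<in> D\<close> show "x \<in> {x \<in> carrier G. g \<otimes>\<^bsub>G\<^esub> x \<in> D}" by simp
  next
    fix x assume x: "x \<in> {x \<in> carrier G. g \<otimes>\<^bsub>G\<^esub> x \<in> D}"
    then have "x @ (g \<otimes>\<^bsub>G\<^esub> x) \<in> tuples (univ M) (n + n)"
      using tup[of x] tup[of "g \<otimes>\<^bsub>G\<^esub> x"] g by (auto simp: tuples_def)
    moreover have "g @ x @ (g \<otimes>\<^bsub>G\<^esub> x) \<in> ?\<Gamma>"
      using x g by blast
    moreover have "drop n (x @ (g \<otimes>\<^bsub>G\<^esub> x)) = g \<otimes>\<^bsub>G\<^esub> x"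
      using x len by simp
    ultimately have "x @ (g \<otimes>\<^bsub>G\<^esub> x) \<in> ?S \<inter> ?C"
      using x by (intro IntI CollectI conjI) simp_all
    moreover have "x \<in> tuples (univ M) n" "g \<otimes>\<^bsub>G\<^esub> x \<in> tuples (univ M) n"
      using x g tup by simp_all
    ultimately show "x \<in> ?P" by blast
  qed
  ultimately show ?thesis by simp
qed

section \<open>Operations on logically right uniformly continuous functions\<close>

lemma logically_rucE:
  assumes "logically_ruc M n G f" "\<epsilon> > 0"
  obtains \<Theta> :: "nat \<Rightarrow> 'm list set"
    where "\<And>k. definable M n (\<Theta> k)" "\<And>k. \<Theta> k \<subseteq> carrier G" "carrier G \<subseteq> (\<Union>k. \<Theta> k)"
      "\<And>k g\<^sub>1 g\<^sub>2 h. g\<^sub>1 \<in> \<Theta> k \<Longrightarrow> g\<^sub>2 \<in> \<Theta> k \<Longrightarrow> h \<in> carrier G \<Longrightarrow>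
         \<bar>f (g\<^sub>1 \<otimes>\<^bsub>G\<^esub> h) - f (g\<^sub>2 \<otimes>\<^bsub>G\<^esub> h)\<bar> < \<epsilon>"
  using assms unfolding logically_ruc_def by meson

lemma lRUC_bounded:
  assumes "f \<in> lRUC M n G"
  obtains B where "\<And>x. x \<in> carrier G \<Longrightarrow> \<bar>f x\<bar> \<le> B"
  using assms unfolding lRUC_def by blast

lemma lRUC_add:
  fixes G :: "('m list, 'b) monoid_scheme"
  assumes "group G" "f \<in> lRUC M n G" "h \<in> lRUC M n G"
  shows "(\<lambda>x\<in>carrier G. f x + h x) \<in> lRUC M n G"
proof -
  interpret group G by fact
  obtain B where B: "\<And>x. x \<in> carrier G \<Longrightarrow> \<bar>f x\<bar> \<le> B"
    using lRUC_bounded[OF assms(2)] by blast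
  obtain C where C: "\<And>x. x \<in> carrier G \<Longrightarrow> \<bar>h x\<bar> \<le> C"
    using lRUC_bounded[OF assms(3)] by blast
  have "logically_ruc M n G (\<lambda>x\<in>carrier G. f x + h x)"
    unfolding logically_ruc_def
  proof (intro allI impI)
    fix \<epsilon> :: real assume "\<epsilon> > 0"
    then have \<epsilon>: "\<epsilon> / 2 > 0" by simp
    have ruc: "logically_ruc M n G f" "logically_ruc M n G h"
      using assms by (auto simp: lRUC_def)
    obtain \<Theta> where \<Theta>: "\<And>k. definable M n (\<Theta> k)" "\<And>k. \<Theta> k \<subseteq> carrier G"
      "carrier G \<subseteq> (\<Union>k::nat. \<Theta> k)"
      "\<And>k a b c. a \<in> \<Theta> k \<Longrightarrow> b \<in> \<Theta> k \<Longrightarrow> c \<in> carrier G \<Longrightarrow>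
         \<bar>f (a \<otimes>\<^bsub>G\<^esub> c) - f (b \<otimes>\<^bsub>G\<^esub> c)\<bar> < \<epsilon> / 2"
      using logically_rucE[OF ruc(1) \<epsilon>] by metis
    obtain \<Xi> where \<Xi>: "\<And>k. definable M n (\<Xi> k)" "\<And>k. \<Xi> k \<subseteq> carrier G"
      "carrier G \<subseteq> (\<Union>k::nat. \<Xi> k)"
      "\<And>k a b c. a \<in> \<Xi> k \<Longrightarrow> b \<in> \<Xi> k \<Longrightarrow> c \<in> carrier G \<Longrightarrow>
         \<bar>h (a \<otimes>\<^bsub>G\<^esub> c) - h (b \<otimes>\<^bsub>G\<^esub> c)\<bar> < \<epsilon> / 2"
      using logically_rucE[OF ruc(2) \<epsilon>] by metis
    \<comment> \<open>The common refinement of the two covers.\<close>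
    define \<Lambda> where "\<Lambda> = (\<lambda>k. \<Theta> (fst (prod_decode k)) \<inter> \<Xi> (snd (prod_decode k)))"
    show "\<exists>\<Lambda>::nat \<Rightarrow> 'm list set. (\<forall>k. definable M n (\<Lambda> k) \<and> \<Lambda> k \<subseteq> carrier G) \<and>
        carrier G \<subseteq> (\<Union>k. \<Lambda> k) \<and>
        (\<forall>k. \<forall>a\<in>\<Lambda> k. \<forall>b\<in>\<Lambda> k. \<forall>c\<in>carrier G.
           \<bar>(\<lambda>x\<in>carrier G. f x + h x) (a \<otimes>\<^bsub>G\<^esub> c)
             - (\<lambda>x\<in>carrier G. f x + h x) (b \<otimes>\<^bsub>G\<^esub> c)\<bar> < \<epsilon>)"
    proof (intro exI[of _ \<Lambda>] conjI allI ballI subsetI)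
      fix k
      show "definable M n (\<Lambda> k)"
        unfolding \<Lambda>_def using \<Theta>(1) \<Xi>(1) by (rule definable_Int)
      show "x \<in> carrier G" if "x \<in> \<Lambda> k" for x
        using that \<Theta>(2) unfolding \<Lambda>_def by blast
    next
      fix x assume "x \<in> carrier G"
      then obtain i j where "x \<in> \<Theta> i" "x \<in> \<Xi> j"
        using \<Theta>(3) \<Xi>(3) by blast
      then have "x \<in> \<Lambda> (prod_encode (i, j))"
        by (simp add: \<Lambda>_def)
      then show "x \<in> (\<Union>k. \<Lambda> k)" by blast
    next
      fix k a b c assume ab: "a \<in> \<Lambda> k" "b \<in> \<Lambda> k" and c: "c \<in> carrier G"
      have "a \<in> carrier G" "b \<in> carrier G"
        using ab \<Theta>(2) unfolding \<Lambda>_def by blast+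
      moreover have "\<bar>f (a \<otimes>\<^bsub>G\<^esub> c) - f (b \<otimes>\<^bsub>G\<^esub> c)\<bar> < \<epsilon> / 2"
        using ab c by (intro \<Theta>(4)) (auto simp: \<Lambda>_def)
      moreover have "\<bar>h (a \<otimes>\<^bsub>G\<^esub> c) - h (b \<otimes>\<^bsub>G\<^esub> c)\<bar> < \<epsilon> / 2"
        using ab c by (intro \<Xi>(4)) (auto simp: \<Lambda>_def)
      ultimately show "\<bar>(\<lambda>x\<in>carrier G. f x + h x) (a \<otimes>\<^bsub>G\<^esub> c)
          - (\<lambda>x\<in>carrier G. f x + h x) (b \<otimes>\<^bsub>G\<^esub> c)\<bar> < \<epsilon>"
        using c by (simp del: less_divide_eq_numeral1)
    qed
  qed
  moreover have "\<bar>(\<lambda>x\<in>carrier G. f x + h x) x\<bar> \<le> B + C" if "x \<in> carrier G" for x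
    using that B[OF that] C[OF that] by simp
  ultimately show ?thesis
    unfolding lRUC_def by blast
qed

lemma lRUC_scale:
  fixes G :: "('m list, 'b) monoid_scheme"
  assumes "group G" "f \<in> lRUC M n G"
  shows "(\<lambda>x\<in>carrier G. c * f x) \<in> lRUC M n G"
proof -
  interpret group G by fact
  obtain B where B: "\<And>x. x \<in> carrier G \<Longrightarrow> \<bar>f x\<bar> \<le> B"
    using lRUC_bounded[OF assms(2)] by blast
  have "logically_ruc M n G (\<lambda>x\<in>carrier G. c * f x)"
    unfolding logically_ruc_def
  proof (intro allI impI)
    fix \<epsilon> :: real assume \<epsilon>: "\<epsilon> > 0"
    have ruc: "logically_ruc M n G f"
      using assms by (auto simp: lRUC_def)
    \<comment> \<open>The summand 1 covers the case \<open>c = 0\<close>.\<close>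
    have \<delta>: "\<epsilon> / (\<bar>c\<bar> + 1) > 0" using \<epsilon> by (simp add: add_nonneg_pos)
    obtain \<Theta> where \<Theta>: "\<And>k. definable M n (\<Theta> k)" "\<And>k. \<Theta> k \<subseteq> carrier G"
      "carrier G \<subseteq> (\<Union>k::nat. \<Theta> k)"
      "\<And>k a b x. a \<in> \<Theta> k \<Longrightarrow> b \<in> \<Theta> k \<Longrightarrow> x \<in> carrier G \<Longrightarrow>
         \<bar>f (a \<otimes>\<^bsub>G\<^esub> x) - f (b \<otimes>\<^bsub>G\<^esub> x)\<bar> < \<epsilon> / (\<bar>c\<bar> + 1)"
      using logically_rucE[OF ruc \<delta>] by metis
    have "\<bar>(\<lambda>x\<in>carrier G. c * f x) (a \<otimes>\<^bsub>G\<^esub> x) - (\<lambda>x\<in>carrier G. c * f x) (b \<otimes>\<^bsub>G\<^esub> x)\<bar> < \<epsilon>"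
      if ab: "a \<in> \<Theta> k" "b \<in> \<Theta> k" and x: "x \<in> carrier G" for k a b x
    proof -
      let ?d = "\<bar>f (a \<otimes>\<^bsub>G\<^esub> x) - f (b \<otimes>\<^bsub>G\<^esub> x)\<bar>"
      have "a \<in> carrier G" "b \<in> carrier G"
        using ab \<Theta>(2) by blast+
      then have "\<bar>(\<lambda>x\<in>carrier G. c * f x) (a \<otimes>\<^bsub>G\<^esub> x) - (\<lambda>x\<in>carrier G. c * f x) (b \<otimes>\<^bsub>G\<^esub> x)\<bar>
          = \<bar>c\<bar> * ?d"
        using x by (simp add: abs_mult[symmetric] right_diff_distrib)
      also have "\<dots> \<le> (\<bar>c\<bar> + 1) * ?d"
        by (intro mult_right_mono) auto
      also have "\<dots> < (\<bar>c\<bar> + 1) * (\<epsilon> / (\<bar>c\<bar> + 1))"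
        using \<Theta>(4)[OF ab x] by (intro mult_strict_left_mono) auto
      also have "\<dots> = \<epsilon>"
        using abs_ge_zero[of c] by simp
      finally show ?thesis .
    qed
    with \<Theta>(1-3) show "\<exists>\<Theta>::nat \<Rightarrow> 'm list set. (\<forall>k. definable M n (\<Theta> k) \<and> \<Theta> k \<subseteq> carrier G) \<and>
        carrier G \<subseteq> (\<Union>k. \<Theta> k) \<and>
        (\<forall>k. \<forall>a\<in>\<Theta> k. \<forall>b\<in>\<Theta> k. \<forall>x\<in>carrier G.
           \<bar>(\<lambda>x\<in>carrier G. c * f x) (a \<otimes>\<^bsub>G\<^esub> x)
             - (\<lambda>x\<in>carrier G. c * f x) (b \<otimes>\<^bsub>G\<^esub> x)\<bar> < \<epsilon>)"
      by (intro exI[of _ \<Theta>]) blast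
  qed
  moreover have "\<bar>(\<lambda>x\<in>carrier G. c * f x) x\<bar> \<le> \<bar>c\<bar> * B" if "x \<in> carrier G" for x
    using that B[OF that] by (simp add: abs_mult mult_left_mono)
  ultimately show ?thesis
    unfolding lRUC_def by blast
qed

text \<open>Since \<open>f (g (x h)) = f ((g x) h)\<close>, a cover that works for \<open>f\<close> becomes one for the translate
  by pulling it back along \<open>x \<mapsto> g x\<close>.\<close>

lemma lRUC_translate:
  fixes G :: "('m list, 'b) monoid_scheme"
  assumes G: "definable_group M n G" and f: "f \<in> lRUC M n G" and g: "g \<in> carrier G"
  shows "translate G g f \<in> lRUC M n G"
proof -
  interpret group G using definable_group_carrier(1)[OF G] .
  obtain B where B: "\<And>x. x \<in> carrier G \<Longrightarrow> \<bar>f x\<bar> \<le> B"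
    using lRUC_bounded[OF f] by blast
  have "logically_ruc M n G (translate G g f)"
    unfolding logically_ruc_def
  proof (intro allI impI)
    fix \<epsilon> :: real assume \<epsilon>: "\<epsilon> > 0"
    have ruc: "logically_ruc M n G f"
      using f by (auto simp: lRUC_def)
    obtain \<Theta> where \<Theta>: "\<And>k. definable M n (\<Theta> k)" "\<And>k. \<Theta> k \<subseteq> carrier G"
      "carrier G \<subseteq> (\<Union>k::nat. \<Theta> k)"
      "\<And>k a b x. a \<in> \<Theta> k \<Longrightarrow> b \<in> \<Theta> k \<Longrightarrow> x \<in> carrier G \<Longrightarrow>
         \<bar>f (a \<otimes>\<^bsub>G\<^esub> x) - f (b \<otimes>\<^bsub>G\<^esub> x)\<bar> < \<epsilon>"
      using logically_rucE[OF ruc \<epsilon>] by metis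
    define \<Xi> where "\<Xi> = (\<lambda>k. {x \<in> carrier G. g \<otimes>\<^bsub>G\<^esub> x \<in> \<Theta> k})"
    have "definable M n (\<Xi> k)" for k
      unfolding \<Xi>_def by (rule definable_left_translation_preimage[OF G g \<Theta>(1,2)])
    moreover have "carrier G \<subseteq> (\<Union>k. \<Xi> k)"
      using \<Theta>(3) g unfolding \<Xi>_def by blast
    moreover have "\<bar>translate G g f (a \<otimes>\<^bsub>G\<^esub> x) - translate G g f (b \<otimes>\<^bsub>G\<^esub> x)\<bar> < \<epsilon>"
      if "a \<in> \<Xi> k" "b \<in> \<Xi> k" "x \<in> carrier G" for k a b x
      using that g \<Theta>(4)[of "g \<otimes>\<^bsub>G\<^esub> a" k "g \<otimes>\<^bsub>G\<^esub> b" x]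
      by (simp add: \<Xi>_def translate_def m_assoc)
    moreover have "\<Xi> k \<subseteq> carrier G" for k
      unfolding \<Xi>_def by blast
    ultimately show "\<exists>\<Theta>::nat \<Rightarrow> 'm list set. (\<forall>k. definable M n (\<Theta> k) \<and> \<Theta> k \<subseteq> carrier G) \<and>
        carrier G \<subseteq> (\<Union>k. \<Theta> k) \<and>
        (\<forall>k. \<forall>a\<in>\<Theta> k. \<forall>b\<in>\<Theta> k. \<forall>x\<in>carrier G.
           \<bar>translate G g f (a \<otimes>\<^bsub>G\<^esub> x) - translate G g f (b \<otimes>\<^bsub>G\<^esub> x)\<bar> < \<epsilon>)"
      by (intro exI[of _ \<Xi>]) blast
  qed
  moreover have "\<bar>translate G g f x\<bar> \<le> B" if "x \<in> carrier G" for x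
    using that g B by (simp add: translate_def)
  moreover have "translate G g f \<in> extensional (carrier G)"
    by (simp add: translate_def)
  ultimately show ?thesis
    unfolding lRUC_def by blast
qed

section \<open>Means and the action on them\<close>

lemma Mean_add:
  "F \<in> Mean M n G \<Longrightarrow> f \<in> lRUC M n G \<Longrightarrow> h \<in> lRUC M n G \<Longrightarrow>
     F (\<lambda>x\<in>carrier G. f x + h x) = F f + F h"
  by (simp add: Mean_def)

lemma Mean_scale:
  "F \<in> Mean M n G \<Longrightarrow> f \<in> lRUC M n G \<Longrightarrow> F (\<lambda>x\<in>carrier G. c * f x) = c * F f"
  by (simp add: Mean_def)

lemma Mean_bounds:
  assumes "F \<in> Mean M n G" "f \<in> lRUC M n G"
  shows "(INF x\<in>carrier G. f x) \<le> F f" "F f \<le> (SUP x\<in>carrier G. f x)"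
  using assms by (auto simp: Mean_def)

text \<open>Apply the bounds for means to the difference of the two functions, which is in \<open>lRUC\<close>.\<close>

lemma Mean_diff_le:
  assumes G: "group G" and F: "F \<in> Mean M n G" and f: "f \<in> lRUC M n G" and h: "h \<in> lRUC M n G"
    and le: "\<And>x. x \<in> carrier G \<Longrightarrow> \<bar>f x - h x\<bar> \<le> \<epsilon>"
  shows "\<bar>F f - F h\<bar> \<le> \<epsilon>"
proof -
  interpret group G by fact
  let ?h = "\<lambda>x\<in>carrier G. - 1 * h x"
  let ?d = "\<lambda>x\<in>carrier G. f x + ?h x"
  have h': "?h \<in> lRUC M n G" using G h by (rule lRUC_scale)
  have d: "?d \<in> lRUC M n G" using G f h' by (rule lRUC_add)
  have "F ?d = F f - F h"
    using Mean_add[OF F f h'] Mean_scale[OF F h, of "- 1"] by simp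
  moreover have "- \<epsilon> \<le> (INF x\<in>carrier G. ?d x)"
  proof (rule cINF_greatest)
    show "- \<epsilon> \<le> ?d x" if "x \<in> carrier G" for x
      using that le[OF that] by simp
  qed auto
  moreover have "(SUP x\<in>carrier G. ?d x) \<le> \<epsilon>"
  proof (rule cSUP_least)
    show "?d x \<le> \<epsilon>" if "x \<in> carrier G" for x
      using that le[OF that] by simp
  qed auto
  ultimately show ?thesis
    using Mean_bounds[OF F d] by linarith
qed

text \<open>A function and its translate have the same range because \<open>x \<mapsto> g x\<close> permutes \<open>G\<close>; hence the
  bounds for \<open>F\<close> at the translate are those required at the function itself.\<close>

lemma translate_image:
  assumes "group G" "g \<in> carrier G"
  shows "translate G g f ` carrier G = f ` carrier G"
proof -
  interpret group G by fact
  have "(\<otimes>\<^bsub>G\<^esub>) g ` carrier G = carrier G"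
    using assms(2) by (rule surj_const_mult)
  then have "f ` carrier G = (\<lambda>x. f (g \<otimes>\<^bsub>G\<^esub> x)) ` carrier G"
    by (metis image_image)
  then show ?thesis
    by (simp add: translate_def)
qed

lemma mean_action_in_Mean:
  assumes G: "definable_group M n G" and g: "g \<in> carrier G" and F: "F \<in> Mean M n G"
  shows "mean_action M n G g F \<in> Mean M n G"
proof -
  interpret group G using definable_group_carrier(1)[OF G] .
  have grp: "group G" ..
  have tr: "translate G g f \<in> lRUC M n G" if "f \<in> lRUC M n G" for f
    using G that g by (rule lRUC_translate)
  have add: "translate G g (\<lambda>x\<in>carrier G. f x + h x)
      = (\<lambda>x\<in>carrier G. translate G g f x + translate G g h x)" for f h
    using g by (auto simp: translate_def fun_eq_iff)
  have scale: "translate G g (\<lambda>x\<in>carrier G. c * f x)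
      = (\<lambda>x\<in>carrier G. c * translate G g f x)" for c f
    using g by (auto simp: translate_def fun_eq_iff)
  show ?thesis
    unfolding Mean_def
  proof (intro CollectI conjI ballI allI)
    show "mean_action M n G g F \<in> extensional (lRUC M n G)"
      by (simp add: mean_action_def)
  next
    fix f h assume f: "f \<in> lRUC M n G" and h: "h \<in> lRUC M n G"
    then show "mean_action M n G g F (\<lambda>x\<in>carrier G. f x + h x)
        = mean_action M n G g F f + mean_action M n G g F h"
      using lRUC_add[OF grp f h] Mean_add[OF F tr[OF f] tr[OF h]]
      by (simp add: mean_action_def add)
  next
    fix c f assume f: "f \<in> lRUC M n G"
    then show "mean_action M n G g F (\<lambda>x\<in>carrier G. c * f x) = c * mean_action M n G g F f"
      using lRUC_scale[OF grp f] Mean_scale[OF F tr[OF f]]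
      by (simp add: mean_action_def scale)
  next
    fix f assume f: "f \<in> lRUC M n G"
    then show "(INF x\<in>carrier G. f x) \<le> mean_action M n G g F f"
      "mean_action M n G g F f \<le> (SUP x\<in>carrier G. f x)"
      using Mean_bounds[OF F tr[OF f]]
      by (simp_all add: mean_action_def translate_image[OF grp g])
  qed
qed

section \<open>Sigma-continuity of the action\<close>

text \<open>The subsets of \<open>Y\<close> with preimage in \<open>\<Sigma>\<close> form a \<open>\<sigma>\<close>-topology, so it suffices that this
  \<open>\<sigma>\<close>-topology contains the generators.\<close>

lemma sigma_continuous_map_generated:
  assumes \<Sigma>: "sigma_topology X \<Sigma>" and \<B>: "\<B> \<subseteq> Pow Y" and \<phi>: "\<phi> \<in> X \<rightarrow> Y"
    and pre: "\<And>W. W \<in> \<B> \<Longrightarrow> {x \<in> X. \<phi> x \<in> W} \<in> \<Sigma>"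
  shows "sigma_continuous_map X \<Sigma> Y (sigma_topology_generated_by Y \<B>) \<phi>"
proof -
  let ?\<T> = "{W \<in> Pow Y. {x \<in> X. \<phi> x \<in> W} \<in> \<Sigma>}"
  have "sigma_topology Y ?\<T>"
    unfolding sigma_topology_def
  proof (intro conjI ballI allI impI)
    have "{x \<in> X. \<phi> x \<in> Y} = X" using \<phi> by blast
    then show "{} \<in> ?\<T>" "Y \<in> ?\<T>"
      using \<Sigma> by (auto simp: sigma_topology_def)
  next
    fix A B assume AB: "A \<in> ?\<T>" "B \<in> ?\<T>"
    have "{x \<in> X. \<phi> x \<in> A \<inter> B} = {x \<in> X. \<phi> x \<in> A} \<inter> {x \<in> X. \<phi> x \<in> B}" by blast
    moreover have "\<dots> \<in> \<Sigma>"
      using AB \<Sigma> by (simp add: sigma_topology_def)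
    ultimately show "A \<inter> B \<in> ?\<T>" using AB by auto
  next
    fix \<A> assume \<A>: "\<A> \<subseteq> ?\<T> \<and> countable \<A>"
    let ?P = "(\<lambda>W. {x \<in> X. \<phi> x \<in> W}) ` \<A>"
    have "?P \<subseteq> \<Sigma>" "countable ?P" using \<A> by auto
    then have "\<Union>?P \<in> \<Sigma>" using \<Sigma> by (simp add: sigma_topology_def)
    moreover have "\<Union>?P = {x \<in> X. \<phi> x \<in> \<Union>\<A>}" by blast
    ultimately show "\<Union>\<A> \<in> ?\<T>" using \<A> by auto
  qed blast
  moreover have "\<B> \<subseteq> ?\<T>" using \<B> pre by blast
  ultimately have "sigma_topology_generated_by Y \<B> \<subseteq> ?\<T>"
    by (rule sigma_topology_generated_by(3)[OF \<B>])
  with \<phi> show ?thesis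
    unfolding sigma_continuous_map_def by blast
qed

lemma mean_subbasis_subset: "mean_subbasis M n G \<subseteq> Pow (Mean M n G)"
  unfolding mean_subbasis_def by blast

lemma group_mean_sigma_generators:
  "{D \<times> (Mean M n G \<inter> \<Inter>\<W>) | D \<W>.
      definable M n D \<and> D \<subseteq> carrier G \<and> finite \<W> \<and> \<W> \<subseteq> mean_subbasis M n G}
    \<subseteq> Pow (carrier G \<times> Mean M n G)"
  by blast

lemma sigma_topology_group_mean:
  "sigma_topology (carrier G \<times> Mean M n G) (group_mean_sigma M n G)"
  unfolding group_mean_sigma_def
  by (rule sigma_topology_generated_by(1)[OF group_mean_sigma_generators])

lemma group_mean_sigma_box:
  assumes "definable M n D" "D \<subseteq> carrier G" "f \<in> lRUC M n G" "open V"
  shows "D \<times> {F \<in> Mean M n G. F f \<in> V} \<in> group_mean_sigma M n G"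
proof -
  let ?W = "{F \<in> Mean M n G. F f \<in> V}"
  have "?W \<in> mean_subbasis M n G"
    using assms(3,4) unfolding mean_subbasis_def by blast
  moreover have "D \<times> ?W = D \<times> (Mean M n G \<inter> \<Inter>{?W})" by blast
  ultimately have "D \<times> ?W \<in> {D \<times> (Mean M n G \<inter> \<Inter>\<W>) | D \<W>.
      definable M n D \<and> D \<subseteq> carrier G \<and> finite \<W> \<and> \<W> \<subseteq> mean_subbasis M n G}"
    using assms(1,2) by (intro CollectI exI[of _ D] exI[of _ "{?W}"]) simp
  then show ?thesis
    unfolding group_mean_sigma_def
    using sigma_topology_generated_by(2)[OF group_mean_sigma_generators] by blast
qed

text \<open>An open approximation from inside of the set of points whose \<open>\<epsilon>\<close>-neighbourhood lies in \<open>V\<close>.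
  A value known up to \<open>\<epsilon>\<close> lies in \<open>V\<close> as soon as its approximation is in \<open>inner V \<epsilon>\<close>, and
  conversely every value in an open \<open>V\<close> is detected in this way once \<open>\<epsilon>\<close> is small.\<close>

definition inner :: "real set \<Rightarrow> real \<Rightarrow> real set" where
  "inner V \<epsilon> = \<Union>{{s - \<epsilon> <..< s + \<epsilon>} | s. {s - 3 * \<epsilon> <..< s + 3 * \<epsilon>} \<subseteq> V}"

lemma open_inner: "open (inner V \<epsilon>)"
  unfolding inner_def by (intro open_Union) auto

lemma inner_approx:
  assumes "r \<in> inner V \<epsilon>" "\<bar>t - r\<bar> \<le> \<epsilon>"
  shows "t \<in> V"
proof -
  obtain s where s: "{s - 3 * \<epsilon> <..< s + 3 * \<epsilon>} \<subseteq> V" "s - \<epsilon> < r" "r < s + \<epsilon>"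
    using assms(1) by (auto simp: inner_def)
  have "t \<in> {s - 3 * \<epsilon> <..< s + 3 * \<epsilon>}" using s(2,3) assms(2) by auto
  then show ?thesis using s(1) by blast
qed

lemma inner_exhausts:
  assumes "{t - 4 * \<epsilon> <..< t + 4 * \<epsilon>} \<subseteq> V" "\<bar>t - r\<bar> \<le> \<epsilon>" "\<epsilon> > 0"
  shows "r \<in> inner V \<epsilon>"
proof -
  have "{r - 3 * \<epsilon> <..< r + 3 * \<epsilon>} \<subseteq> {t - 4 * \<epsilon> <..< t + 4 * \<epsilon>}"
    using assms(2) by auto
  with assms(1) have "{r - 3 * \<epsilon> <..< r + 3 * \<epsilon>} \<subseteq> V" by blast
  moreover have "r \<in> {r - \<epsilon> <..< r + \<epsilon>}" using assms(3) by simp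
  ultimately show ?thesis unfolding inner_def by blast
qed

text \<open>For fixed \<open>\<epsilon>\<close>, the product of \<open>\<Theta> k\<close> with the condition that \<open>F\<close> sends a representative
  translate into \<open>inner V \<epsilon>\<close> lies in the preimage; the union over \<open>k\<close> and over
  \<open>\<epsilon> = 1 / (m + 1)\<close> is the whole preimage.\<close>

lemma mean_action_preimage_sigma_open:
  fixes G :: "('m list, 'b) monoid_scheme"
  assumes G: "definable_group M n G" and f: "f \<in> lRUC M n G" and V: "open V"
  shows "{(g, F) \<in> carrier G \<times> Mean M n G. F (translate G g f) \<in> V} \<in> group_mean_sigma M n G"
    (is "?P \<in> _")
proof -
  interpret group G using definable_group_carrier(1)[OF G] .
  have grp: "group G" ..
  define \<epsilon> :: "nat \<Rightarrow> real" where "\<epsilon> m = 1 / real (Suc m)" for m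
  have \<epsilon>: "\<epsilon> m > 0" for m by (simp add: \<epsilon>_def)
  have ruc: "logically_ruc M n G f" using f by (simp add: lRUC_def)
  let ?cover = "\<lambda>m (\<Theta> :: nat \<Rightarrow> 'm list set). (\<forall>k. definable M n (\<Theta> k) \<and> \<Theta> k \<subseteq> carrier G) \<and>
      carrier G \<subseteq> (\<Union>k. \<Theta> k) \<and>
      (\<forall>k. \<forall>a\<in>\<Theta> k. \<forall>b\<in>\<Theta> k. \<forall>x\<in>carrier G. \<bar>f (a \<otimes>\<^bsub>G\<^esub> x) - f (b \<otimes>\<^bsub>G\<^esub> x)\<bar> < \<epsilon> m)"
  have "\<forall>m. \<exists>\<Theta>. ?cover m \<Theta>"
    using ruc \<epsilon> unfolding logically_ruc_def by blast
  then obtain \<Theta> where cover: "\<forall>m. ?cover m (\<Theta> m)"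
    by (rule choice[THEN exE])
  have \<Theta>: "\<And>m k. definable M n (\<Theta> m k)" "\<And>m k. \<Theta> m k \<subseteq> carrier G"
      "\<And>m. carrier G \<subseteq> (\<Union>k. \<Theta> m k)"
      "\<And>m k a b x. a \<in> \<Theta> m k \<Longrightarrow> b \<in> \<Theta> m k \<Longrightarrow> x \<in> carrier G \<Longrightarrow>
         \<bar>f (a \<otimes>\<^bsub>G\<^esub> x) - f (b \<otimes>\<^bsub>G\<^esub> x)\<bar> < \<epsilon> m"
    using cover by simp_all
  \<comment> \<open>If \<open>\<Theta> m k\<close> is empty, any element of \<open>G\<close> will do.\<close>
  define c where "c m k = (if \<Theta> m k = {} then \<one>\<^bsub>G\<^esub> else SOME x. x \<in> \<Theta> m k)" for m k
  have c: "c m k \<in> \<Theta> m k" if "x \<in> \<Theta> m k" for m k x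
    using that some_in_eq[of "\<Theta> m k"] by (auto simp: c_def)
  have cG: "c m k \<in> carrier G" for m k
  proof (cases "\<Theta> m k = {}")
    case True
    then show ?thesis by (simp add: c_def)
  next
    case False
    then show ?thesis using c \<Theta>(2) by blast
  qed
  have near: "\<bar>F (translate G g f) - F (translate G (c m k) f)\<bar> \<le> \<epsilon> m"
    if g: "g \<in> \<Theta> m k" and F: "F \<in> Mean M n G" for g F m k
  proof (rule Mean_diff_le[OF grp F])
    show "translate G g f \<in> lRUC M n G" "translate G (c m k) f \<in> lRUC M n G"
      using G f g \<Theta>(2) cG by (auto intro: lRUC_translate)
    show "\<bar>translate G g f x - translate G (c m k) f x\<bar> \<le> \<epsilon> m" if "x \<in> carrier G" for x
      using \<Theta>(4)[OF g c[OF g] that] that by (simp add: translate_def)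
  qed
  define Q where
    "Q m k = \<Theta> m k \<times> {F \<in> Mean M n G. F (translate G (c m k) f) \<in> inner V (\<epsilon> m)}" for m k
  have "Q m k \<in> group_mean_sigma M n G" for m k
    unfolding Q_def
    by (intro group_mean_sigma_box \<Theta> lRUC_translate[OF G f cG] open_inner)
  then have "range (case_prod Q) \<subseteq> group_mean_sigma M n G" by auto
  then have "\<Union>(range (case_prod Q)) \<in> group_mean_sigma M n G"
    using sigma_topology_group_mean[of G M n] by (simp add: sigma_topology_def)
  moreover have "\<Union>(range (case_prod Q)) = ?P"
  proof (intro equalityI subsetI)
    fix z assume "z \<in> \<Union>(range (case_prod Q))"
    then obtain m k g F where z: "z = (g, F)" "g \<in> \<Theta> m k" "F \<in> Mean M n G"
      "F (translate G (c m k) f) \<in> inner V (\<epsilon> m)"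
      by (auto simp: Q_def)
    have "F (translate G g f) \<in> V"
      using inner_approx[OF z(4) near[OF z(2,3)]] .
    moreover have "g \<in> carrier G" using z(2) \<Theta>(2) by blast
    ultimately show "z \<in> ?P" using z(1,3) by simp
  next
    fix z assume "z \<in> ?P"
    then obtain g F where z: "z = (g, F)" "g \<in> carrier G" "F \<in> Mean M n G"
      "F (translate G g f) \<in> V" by blast
    obtain \<delta> where \<delta>: "\<delta> > 0" "\<And>r. dist r (F (translate G g f)) < \<delta> \<Longrightarrow> r \<in> V"
      using V z(4) by (meson open_dist)
    obtain m where m: "\<epsilon> m < \<delta> / 4"
      using nat_approx_posE[of "\<delta> / 4"] \<delta>(1) unfolding \<epsilon>_def by auto
    obtain k where k: "g \<in> \<Theta> m k" using \<Theta>(3) z(2) by blast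
    have "{F (translate G g f) - 4 * \<epsilon> m <..< F (translate G g f) + 4 * \<epsilon> m} \<subseteq> V"
      using m by (intro subsetI \<delta>(2)) (auto simp: dist_real_def)
    then have "F (translate G (c m k) f) \<in> inner V (\<epsilon> m)"
      using near[OF k z(3)] \<epsilon> by (rule inner_exhausts)
    then have "z \<in> Q m k" using z k by (simp add: Q_def)
    then show "z \<in> \<Union>(range (case_prod Q))" by auto
  qed
  ultimately show ?thesis by simp
qed

theorem theorem3p5:
  fixes M :: "('f, 'r, 'm) fo_structure"
    and n :: nat
    and G :: "('m list, 'b) monoid_scheme"
  assumes "definable_group M n G"
  shows "sigma_continuous_map
           (carrier G \<times> Mean M n G) (group_mean_sigma M n G)
           (Mean M n G) (mean_sigma M n G)
           (\<lambda>(g, F). mean_action M n G g F)"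
  unfolding mean_sigma_def
proof (rule sigma_continuous_map_generated[OF sigma_topology_group_mean mean_subbasis_subset])
  show "(\<lambda>(g, F). mean_action M n G g F) \<in> carrier G \<times> Mean M n G \<rightarrow> Mean M n G"
    using mean_action_in_Mean[OF assms] by auto
  fix W assume "W \<in> mean_subbasis M n G"
  then obtain f V where W: "W = {F \<in> Mean M n G. F f \<in> V}" and f: "f \<in> lRUC M n G" and V: "open V"
    unfolding mean_subbasis_def by blast
  have "{z \<in> carrier G \<times> Mean M n G. (\<lambda>(g, F). mean_action M n G g F) z \<in> W}
      = {(g, F) \<in> carrier G \<times> Mean M n G. F (translate G g f) \<in> V}"
    using mean_action_in_Mean[OF assms] f by (auto simp: W mean_action_def)
  then show "{z \<in> carrier G \<times> Mean M n G. (\<lambda>(g, F). mean_action M n G g F) z \<in> W}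
      \<in> group_mean_sigma M n G"
    using mean_action_preimage_sigma_open[OF assms f V] by simp
qed

end
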